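(* Let $p$ be a prime and $e\ge 1$ an integer. Let $\alpha=s\frac{p^e-1}{p-1}$ with $0\le s<p-1$, and let $0<\beta<p^{pe}$ be an integer such that (i) $w_p(\beta)=p$; (ii) $w_p\big((\alpha p+\beta)^\dagger\big)=p$; (iii) $\gcd(se+1,p-1)=1$. Let $(\alpha p+\beta)^\dagger=a_0p^0+\cdots+a_{e-1}p^{e-1}$ and $\beta=b_0p^0+\cdots+b_{pe-1}p^{pe-1}$ be the base-$p$ representations. Assume that $\gcd(a_0+a_1x+\cdots+a_{e-1}x^{e-1},\ x^e-1)=x-1$ and $\gcd\big(b_0+(b_0+b_1)x+\cdots+(b_0+\cdots+b_{pe-2})x^{pe-2},\ x^e-1\big)=1$ in $\mathbb{F}_p[x]$. Then, with $n=\alpha(p^{0\cdot e}+p^{1\cdot e}+\cdots+p^{(p-1)e})+\beta$, $g_{n,p}$ is a permutation polynomial of $\mathbb{F}_{p^e}$.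
   Context: For a prime $p$, a power $q$ of $p$ and an integer $n\ge 0$, $g_{n,q}\in\mathbb{F}_p[x]$ is the unique polynomial with $\sum_{a\in\mathbb{F}_q}(x+a)^n=g_{n,q}(x^q-x)$. A permutation polynomial of a finite field $\mathbb{F}$ is a polynomial inducing a bijection of $\mathbb{F}$. $w_p(m)$ denotes the sum of the base-$p$ digits of an integer $m\ge 0$. For $m\in\mathbb{Z}$, $m^\dagger$ denotes the unique integer with $1\le m^\dagger\le p^e-1$ and $m^\dagger\equiv m\pmod{p^e-1}$. *)

theory Defs
  imports Berlekamp_Zassenhaus.Finite_Field "HOL-Computational_Algebra.Computational_Algebra"
    "HOL-Number_Theory.Cong"
begin

definition base_digit :: "nat \<Rightarrow> nat \<Rightarrow> nat \<Rightarrow> nat" where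
  "base_digit p m i = m div p ^ i mod p"

(* For p \<ge> 2 all digits of m at positions beyond m vanish (m < p ^ m), so the sum over i \<le> m
   runs over all nonzero digits. *)
definition digit_sum :: "nat \<Rightarrow> nat \<Rightarrow> nat" where
  "digit_sum p m = (\<Sum>i\<le>m. base_digit p m i)"

(* The representative of m modulo p ^ e - 1 in {1..p ^ e - 1} (not in {0..<p ^ e - 1}). *)
definition dagger :: "nat \<Rightarrow> nat \<Rightarrow> int \<Rightarrow> nat" where
  "dagger p e m = (THE k. 1 \<le> k \<and> k \<le> p ^ e - 1 \<and> [int k = m] (mod (int p ^ e - 1)))"

(* The type 'p mod_ring with 'p :: prime_card is the prime field with CARD('p) elements. If 'a is a
   field of characteristic CARD('p), then of_Fp is its unique embedding into 'a. *)
definition of_Fp :: "'p::prime_card mod_ring \<Rightarrow> 'a::comm_ring_1" where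
  "of_Fp c = of_int (to_int_mod_ring c)"

(* g_poly TYPE('q) n is the polynomial g_{n,q} with q = CARD('q); it is meaningful when q is a
   power of p = CARD('p). The defining identity is one of polynomials over 'q, while g itself has
   coefficients in the prime field. *)
definition g_poly :: "'q::{field,finite} itself \<Rightarrow> nat \<Rightarrow> 'p::prime_card mod_ring poly" where
  "g_poly _ n = (THE g. (\<Sum>a\<in>(UNIV :: 'q set). [:a, 1:] ^ n) =
     pcompose (map_poly of_Fp g) (monom 1 CARD('q) - monom 1 1))"

(* f is a permutation polynomial of the extension field 'a of the prime field. *)
definition permutation_poly :: "'a::{field,finite} itself \<Rightarrow> 'p::prime_card mod_ring poly \<Rightarrow> bool" where
  "permutation_poly _ f \<longleftrightarrow> bij (\<lambda>x::'a. poly (map_poly of_Fp f) x)"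

end

theory Submission
  imports Defs "Berlekamp_Zassenhaus.Berlekamp_Type_Based" "HOL-Number_Theory.Residues"
begin

text \<open>
  Evaluate g at a point x of the field F with p^e elements by computing in F[Y] modulo the
  Artin-Schreier polynomial Y^p - Y - x, where Y^(p^i) is Y + x + x^p + ... + x^(p^(i-1)) and hence
  Y^(p^(je)) is Y + jt with t the trace of x. The product over j < p of Y + a + jt is x if t is not 0, and
  (Y + a)^p otherwise; this disposes of the part of n that involves alpha. Since the remaining exponent has
  digit sum p, the sum over a becomes a linearized polynomial in x. Up to an additive constant, g is thus
  x^alpha L(x) off the kernel of the trace and L'(x) on it. The second gcd condition makes L bijective, the
  first one makes L' injective on the kernel of the trace. The trace of the value tells the two cases apart,
  and since x^alpha lies in the prime field, condition (iii) gives injectivity in the first case.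
\<close>

section \<open>Power sums and products over the prime field\<close>

lemma of_Fp_hom:
  assumes "CHAR('a::comm_ring_1) = CARD('p::prime_card)"
  shows "comm_ring_hom (of_Fp :: 'p mod_ring \<Rightarrow> 'a)"
proof
  fix x y :: "'p mod_ring"
  have r: "(of_int (k mod int CARD('p)) :: 'a) = of_int k" for k
    using of_int_mod_CHAR[where 'a = 'a, of k] by (simp add: assms)
  show "(of_Fp (x + y) :: 'a) = of_Fp x + of_Fp y"
    by (simp add: of_Fp_def to_int_mod_ring_add r)
  show "(of_Fp (x * y) :: 'a) = of_Fp x * of_Fp y"
    by (simp add: of_Fp_def to_int_mod_ring_mult r)
qed (simp_all add: of_Fp_def)

lemma of_Fp_self [simp]: "of_Fp c = (c :: 'p::prime_card mod_ring)"
  by (simp add: of_Fp_def of_int_of_int_mod_ring)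

lemma of_Fp_poly: "(of_Fp c :: 'a::comm_ring_1 poly) = [:of_Fp c:]"
  by (simp add: of_Fp_def of_int_poly)

lemma bij_betw_of_nat_mod_ring: "bij_betw of_nat {..<CARD('p::prime_card)} (UNIV :: 'p mod_ring set)"
proof -
  have s: "of_nat ` {..<CARD('p)} = (UNIV :: 'p mod_ring set)"
    using surj_of_nat_mod_ring[where 'a = 'p] by (auto simp: image_iff) 
  hence "inj_on (of_nat :: _ \<Rightarrow> 'p mod_ring) {..<CARD('p)}"
    by (intro eq_card_imp_inj_on) (simp_all)
  with s show ?thesis by (simp add: bij_betw_def)
qed

lemma mod_ring_power_card: "(a :: 'p::prime_card mod_ring) ^ CARD('p) = a"
  using finite_field_power_card_eq_same[of a] by simp

lemma mod_ring_power_pred_card: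
  assumes "(a :: 'p::prime_card mod_ring) \<noteq> 0"
  shows "a ^ (CARD('p) - 1) = 1"
proof -
  have "a * a ^ (CARD('p) - 1) = a ^ CARD('p)"
    by (simp flip: power_Suc)
  with assms show ?thesis by (simp add: mod_ring_power_card)
qed

text \<open>For \<open>k > 0\<close> the polynomial X^k - 1 has fewer than p - 1 roots, so some unit
  u has u^k different from 1; substituting u a for a multiplies the sum by u^k. For
  \<open>k = 0\<close> the sum is p times 1.\<close>

lemma power_sum_mod_ring_small:
  assumes "k < CARD('p::prime_card) - 1"
  shows "(\<Sum>a\<in>UNIV. (a :: 'p mod_ring) ^ k) = 0"
proof (cases "k = 0")
  case False
  have "\<exists>u :: 'p mod_ring. u \<noteq> 0 \<and> u ^ k \<noteq> 1"
  proof (rule ccontr)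
    assume *: "\<not> ?thesis"
    let ?f = "monom 1 k - 1 :: 'p mod_ring poly"
    have "coeff ?f k = 1" using False by simp
    hence nz: "?f \<noteq> 0" by fastforce
    have deg: "degree ?f \<le> k"
      by (rule degree_diff_le) (simp_all add: degree_monom_le)
    have "card (UNIV - {0 :: 'p mod_ring}) \<le> card {x. poly ?f x = 0}"
      using * by (intro card_mono) (auto simp: poly_monom)
    also have "\<dots> \<le> k"
      using card_poly_roots_bound[OF nz] deg by simp
    finally show False using assms by simp
  qed
  then obtain u :: "'p mod_ring" where u: "u \<noteq> 0" "u ^ k \<noteq> 1" by blast
  have "(\<Sum>a\<in>UNIV. a ^ k) = (\<Sum>a\<in>UNIV. (u * a) ^ k)"
    by (rule sum.reindex_bij_witness[of _ "\<lambda>a. u * a" "\<lambda>a. a / u"]) (use u in auto)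
  also have "\<dots> = u ^ k * (\<Sum>a\<in>UNIV. a ^ k)"
    by (simp add: power_mult_distrib sum_distrib_left)
  finally show ?thesis using u by (simp add: mult_cancel_right1)
qed simp

lemma power_sum_mod_ring_pred: "(\<Sum>a\<in>UNIV. (a :: 'p::prime_card mod_ring) ^ (CARD('p) - 1)) = -1"
proof -
  have p: "CARD('p) > 1" using prime_card[where 'a = 'p] prime_gt_1_nat by blast
  have "(\<Sum>a\<in>UNIV. (a :: 'p mod_ring) ^ (CARD('p) - 1)) = (\<Sum>a\<in>UNIV - {0::'p mod_ring}. 1)"
    using p by (intro sum.mono_neutral_cong_right) (auto simp: mod_ring_power_pred_card[unfolded One_nat_def])
  also have "\<dots> = of_nat (CARD('p) - 1)" by simp
  also have "\<dots> = -1" using p by (subst of_nat_diff) auto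
  finally show ?thesis .
qed

lemma power_sum_Fp:
  assumes "CHAR('a::comm_ring_1) = CARD('p::prime_card)"
  shows "k < CARD('p) - 1 \<Longrightarrow> (\<Sum>a\<in>UNIV. (of_Fp (a :: 'p mod_ring) :: 'a) ^ k) = 0"
    and "k = CARD('p) - 1 \<Longrightarrow> (\<Sum>a\<in>UNIV. (of_Fp (a :: 'p mod_ring) :: 'a) ^ k) = -1"
    and "k = CARD('p) \<Longrightarrow> (\<Sum>a\<in>UNIV. (of_Fp (a :: 'p mod_ring) :: 'a) ^ k) = of_Fp (\<Sum>a\<in>(UNIV :: 'p mod_ring set). a)"
proof -
  interpret h: comm_ring_hom "of_Fp :: 'p mod_ring \<Rightarrow> 'a" by (rule of_Fp_hom[OF assms])
  have *: "(\<Sum>a\<in>UNIV. (of_Fp (a :: 'p mod_ring) :: 'a) ^ k) = of_Fp (\<Sum>a\<in>UNIV. (a :: 'p mod_ring) ^ k)"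
    by (simp add: h.hom_sum h.hom_power)
  show "k < CARD('p) - 1 \<Longrightarrow> (\<Sum>a\<in>UNIV. (of_Fp (a :: 'p mod_ring) :: 'a) ^ k) = 0"
    unfolding * by (simp add: power_sum_mod_ring_small)
  show "k = CARD('p) - 1 \<Longrightarrow> (\<Sum>a\<in>UNIV. (of_Fp (a :: 'p mod_ring) :: 'a) ^ k) = -1"
    unfolding * using power_sum_mod_ring_pred[where 'p = 'p] by (simp add: h.hom_uminus)
  show "k = CARD('p) \<Longrightarrow> (\<Sum>a\<in>UNIV. (of_Fp (a :: 'p mod_ring) :: 'a) ^ k) = of_Fp (\<Sum>a\<in>(UNIV :: 'p mod_ring set). a)"
    unfolding * by (simp add: mod_ring_power_card)
qed

text \<open>Expanding the product leaves power sums of exponent at most p, of which only the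
  exponents p - 1 and p can survive; the former collects the sum of the z. The factor
  \<open>of_Fp a ^ j\<close> keeps the statement stable under removing the head of the list.\<close>

lemma sum_prod_list_Fp:
  fixes zs :: "'a::comm_ring_1 list"
  assumes "CHAR('a) = CARD('p::prime_card)"
  defines "S \<equiv> \<lambda>j zs. \<Sum>a\<in>UNIV. (of_Fp (a :: 'p mod_ring) :: 'a) ^ j * (\<Prod>z\<leftarrow>zs. z + of_Fp a)"
  shows "length zs + j < CARD('p) - 1 \<Longrightarrow> S j zs = 0"
    and "length zs + j = CARD('p) - 1 \<Longrightarrow> S j zs = -1"
    and "length zs + j = CARD('p) \<Longrightarrow> S j zs = of_Fp (\<Sum>a\<in>(UNIV :: 'p mod_ring set). a) - sum_list zs"
proof -
  have p: "CARD('p) > 1" using prime_card[where 'a = 'p] prime_gt_1_nat by blast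
  have Nil: "S j [] = (\<Sum>a\<in>UNIV. (of_Fp (a :: 'p mod_ring) :: 'a) ^ j)" for j
    by (simp add: S_def)
  have Cons_eq: "S j (z # zs) = z * S j zs + S (Suc j) zs" for j z zs
    by (simp add: S_def algebra_simps sum.distrib sum_distrib_left)
  show 1: "S j zs = 0" if "length zs + j < CARD('p) - 1" for j zs
    using that by (induction zs arbitrary: j)
      (simp_all add: Nil Cons_eq power_sum_Fp[OF assms(1)])
  show 2: "S j zs = -1" if "length zs + j = CARD('p) - 1" for j zs
    using that by (induction zs arbitrary: j)
      (simp_all add: Nil Cons_eq power_sum_Fp[OF assms(1)] 1)
  show "S j zs = of_Fp (\<Sum>a\<in>(UNIV :: 'p mod_ring set). a) - sum_list zs" if "length zs + j = CARD('p)" for j zs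
    using that
  proof (induction zs arbitrary: j)
    case (Cons z zs)
    have "S (Suc j) zs = of_Fp (\<Sum>a\<in>(UNIV :: 'p mod_ring set). a) - sum_list zs"
      using Cons by simp
    moreover have "S j zs = -1" using Cons.prems by (intro 2) simp
    ultimately show ?case by (simp add: Cons_eq)
  qed (simp add: Nil power_sum_Fp[OF assms(1)])
qed

lemma prod_add_of_Fp:
  fixes w :: "'a::comm_ring_1"
  assumes "CHAR('a) = CARD('p::prime_card)"
  shows "(\<Prod>a\<in>UNIV. w + of_Fp (a :: 'p mod_ring)) = w ^ CARD('p) - w"
proof -
  interpret h: comm_ring_hom "of_Fp :: 'p mod_ring \<Rightarrow> 'a" by (rule of_Fp_hom[OF assms])
  interpret m: map_poly_comm_ring_hom "of_Fp :: 'p mod_ring \<Rightarrow> 'a" ..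
  have "(\<Prod>a\<in>UNIV. w + of_Fp (a :: 'p mod_ring)) = (\<Prod>a\<in>UNIV. w - of_Fp (a :: 'p mod_ring))"
    by (rule prod.reindex_bij_witness[of _ uminus uminus]) (auto simp: h.hom_uminus)
  also have "\<dots> = poly (map_poly of_Fp (\<Prod>a\<in>UNIV. [:0, 1:] - [:a :: 'p mod_ring:])) w"
    by (simp add: m.hom_prod poly_prod h.hom_uminus)
  also have "\<dots> = w ^ CARD('p) - w"
    unfolding poly_monom_identity_mod_p[symmetric]
    by (simp add: m.hom_minus poly_monom map_poly_monom)
  finally show ?thesis .
qed

lemma prod_add_of_nat_mult:
  fixes w :: "'f::field poly"
  assumes "CHAR('f) = CARD('p::prime_card)" "t ^ CARD('p) = t" "t \<noteq> 0"
  shows "(\<Prod>j<CARD('p). w + [:of_nat j * t:]) = w ^ CARD('p) - w"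
proof -
  have ch: "CHAR('f poly) = CARD('p)" using assms by simp
  interpret h: comm_ring_hom "of_Fp :: 'p mod_ring \<Rightarrow> 'f poly" by (rule of_Fp_hom[OF ch])
  \<comment> \<open>Dividing by t turns the multiples of t into the prime field; multiplying back by
    t^p = t restores w^p - w.\<close>
  let ?v = "smult (1 / t) w"
  have v: "[:t:] * ?v = w" using assms by simp
  have "(\<Prod>j<CARD('p). w + [:of_nat j * t:]) = (\<Prod>j<CARD('p). [:t:] * (?v + of_Fp (of_nat j :: 'p mod_ring)))"
  proof (rule prod.cong)
    fix j
    have "[:t:] * (?v + of_Fp (of_nat j :: 'p mod_ring)) = w + [:t:] * of_nat j"
      unfolding distrib_left v by (simp only: h.hom_of_nat)
    also have "[:t:] * of_nat j = [:of_nat j * t:]" by (simp add: of_nat_poly mult.commute)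
    finally show "w + [:of_nat j * t:] = [:t:] * (?v + of_Fp (of_nat j :: 'p mod_ring))" ..
  qed simp
  also have "\<dots> = [:t:] ^ CARD('p) * (\<Prod>j<CARD('p). ?v + of_Fp (of_nat j :: 'p mod_ring))"
    by (simp only: prod.distrib prod_constant card_lessThan)
  also have "(\<Prod>j<CARD('p). ?v + of_Fp (of_nat j :: 'p mod_ring)) = (\<Prod>a\<in>UNIV. ?v + of_Fp (a :: 'p mod_ring))"
    by (rule prod.reindex_bij_betw[OF bij_betw_of_nat_mod_ring])
  also have "\<dots> = ?v ^ CARD('p) - ?v" by (rule prod_add_of_Fp[OF ch])
  also have "[:t:] ^ CARD('p) * (?v ^ CARD('p) - ?v) = ([:t:] * ?v) ^ CARD('p) - [:t:] * ?v"
    by (simp only: right_diff_distrib power_mult_distrib) (simp add: poly_const_pow assms(2))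
  finally show ?thesis unfolding v .
qed

section \<open>Base-p digits and representatives modulo p^e - 1\<close>

lemma base_digit_expansion: "(\<Sum>i<N. base_digit p m i * p ^ i) = m mod p ^ N"
proof (induction N)
  case (Suc N)
  have "m mod (p ^ N * p) = p ^ N * (m div p ^ N mod p) + m mod p ^ N" by (rule mod_mult2_eq)
  thus ?case using Suc by (simp add: base_digit_def mult.commute)
qed simp

lemma base_digit_eq_0:
  assumes "m < p ^ N" "N \<le> i" "1 < p"
  shows "base_digit p m i = 0"
proof -
  have "p ^ N \<le> p ^ i" using assms by (intro power_increasing) auto
  hence "m < p ^ i" using assms(1) by simp
  thus ?thesis by (simp add: base_digit_def)
qed

lemma digit_sum_eq:
  assumes "m < p ^ N" "1 < p"
  shows "digit_sum p m = (\<Sum>i<N. base_digit p m i)"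
proof -
  have "m < p ^ m" using power_gt_expt[of p m] assms(2) by simp
  also have "\<dots> \<le> p ^ Suc m" using assms(2) by simp
  finally have m: "m < p ^ Suc m" .
  have "digit_sum p m = (\<Sum>i<Suc m. base_digit p m i)"
    by (simp add: digit_sum_def lessThan_Suc_atMost)
  also have "\<dots> = (\<Sum>i<max N (Suc m). base_digit p m i)"
    using base_digit_eq_0[OF m _ assms(2)] by (intro sum.mono_neutral_left) auto
  also have "\<dots> = (\<Sum>i<N. base_digit p m i)"
    using base_digit_eq_0[OF assms(1) _ assms(2)] by (intro sum.mono_neutral_right) auto
  finally show ?thesis .
qed

lemma dagger_props:
  assumes "1 < p" "1 \<le> e"
  shows "1 \<le> dagger p e m" "dagger p e m < p ^ e" "[int (dagger p e m) = m] (mod (int (p ^ e) - 1))"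
proof -
  define M where "M = int (p ^ e) - 1"
  have pe: "1 < p ^ e" using one_less_power[of p e] assms by simp
  hence "int 1 < int (p ^ e)" by (simp only: of_nat_less_iff)
  hence M: "M > 0" by (simp add: M_def)
  \<comment> \<open>Reducing m - 1 and adding 1 afterwards moves the residue range from 0..M-1 to
    1..M; uniqueness below undoes the shift.\<close>
  define k where "k = nat ((m - 1) mod M + 1)"
  have k: "int k = (m - 1) mod M + 1" using M by (simp add: k_def add_nonneg_nonneg)
  have range: "1 \<le> k \<and> k \<le> p ^ e - 1"
    using M k pos_mod_sign[of M "m - 1"] pos_mod_bound[of M "m - 1"] pe unfolding M_def by linarith
  have cong: "[int k = m] (mod M)"
    unfolding k cong_def by (simp add: mod_add_left_eq)
  have "dagger p e m = k"
    unfolding dagger_def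
  proof (rule the_equality)
    show "1 \<le> k \<and> k \<le> p ^ e - 1 \<and> [int k = m] (mod int p ^ e - 1)"
      using range cong by (simp add: M_def)
    fix l assume l: "1 \<le> l \<and> l \<le> p ^ e - 1 \<and> [int l = m] (mod int p ^ e - 1)"
    hence "[int l = int k] (mod M)"
      using cong cong_trans[of "int l" m M "int k"] cong_sym[of "int k" m M] by (simp add: M_def)
    hence "[int l - 1 = int k - 1] (mod M)" by (intro cong_diff) auto
    moreover have "0 \<le> int l - 1" "int l - 1 < M" "0 \<le> int k - 1" "int k - 1 < M"
      using l range pe unfolding M_def by linarith+
    ultimately show "l = k" by (simp add: cong_def)
  qed
  with range cong pe show "1 \<le> dagger p e m" "dagger p e m < p ^ e" "[int (dagger p e m) = m] (mod (int (p ^ e) - 1))"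
    by (auto simp: M_def)
qed

section \<open>Finite fields and translation-invariant polynomials\<close>

lemma finite_field_power_card:
  fixes x :: "'f::{field,finite}"
  shows "x ^ CARD('f) = x"
proof (cases "x = 0")
  case False
  have "(\<Prod>y\<in>UNIV-{0}. y) = (\<Prod>y\<in>UNIV-{0}. x * y)"
    by (rule prod.reindex_bij_witness[of _ "\<lambda>y. x * y" "\<lambda>y. y / x"]) (use False in auto)
  also have "\<dots> = x ^ (CARD('f) - 1) * (\<Prod>y\<in>UNIV-{0}. y)"
    by (simp add: prod.distrib)
  finally have "x ^ (CARD('f) - 1) = 1" by simp
  moreover have "x ^ CARD('f) = x * x ^ (CARD('f) - 1)"
    by (simp flip: power_Suc)
  ultimately show ?thesis by simp
qed simp

lemma CHAR_eq_of_card: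
  assumes "CARD('f::{field,finite}) = p ^ e" "prime p"
  shows "CHAR('f) = p"
proof -
  have "CHAR('f) > 0" by (intro finite_imp_CHAR_pos) simp
  hence "prime CHAR('f)" by (rule prime_CHAR_semidom)
  moreover have "CHAR('f) dvd p ^ e" using CHAR_dvd_CARD[where 'a = 'f] assms by simp
  ultimately show ?thesis using assms(2) by (metis prime_dvd_power primes_dvd_imp_eq)
qed

text \<open>This supplies the polynomial g. By invariance f - f(0) vanishes on the whole prime
  field, hence is divisible by T = X^p - X; T is itself invariant, so the quotient is too, and for
  nonconstant f it has smaller degree.\<close>

lemma translation_invariant_imp_pcompose:
  fixes f :: "'p::prime_card mod_ring poly"
  assumes "\<And>c. pcompose f [:c, 1:] = f"
  shows "\<exists>g. f = pcompose g (monom 1 CARD('p) - monom 1 1)"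
  using assms
proof (induction "degree f" arbitrary: f rule: less_induct)
  case less
  let ?T = "monom 1 CARD('p) - monom 1 1 :: 'p mod_ring poly"
  show ?case
  proof (cases "degree f = 0")
    case True
    then obtain c where "f = [:c:]" by (rule degree_eq_zeroE)
    thus ?thesis by (intro exI[of _ "[:c:]"]) simp
  next
    case False
    let ?f = "f - [:poly f 0:]"
    have "poly f a = poly f 0" for a
      using arg_cong[OF less.prems[of a], of "\<lambda>q. poly q 0"] by (simp add: poly_pcompose)
    hence "[:0, 1:] - [:a:] dvd ?f" for a
      using poly_eq_0_iff_dvd[of ?f a] by simp
    hence "(\<Prod>x\<in>UNIV. [:0, 1:] - [:x:]) dvd ?f"
      by (intro divides_prod) (auto dest!: coprime_h_c_poly[of _ _ "[:0,1:]"])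
    hence "?T dvd ?f" by (simp only: poly_monom_identity_mod_p)
    then obtain h where h: "?f = ?T * h" by (elim dvdE)
    have T: "pcompose ?T [:c, 1:] = ?T" for c
    proof -
      have "CHAR('p mod_ring poly) = CARD('p)" by simp
      hence "([:0, 1:] + [:c:]) ^ CARD('p) = [:0, 1:] ^ CARD('p) + [:c:] ^ CARD('p)"
        using prime_card[where 'a = 'p] by (intro freshmans_dream) simp_all
      also have "[:c:] ^ CARD('p) = [:c:]"
        using finite_field_power_card_eq_same[of c] by (simp add: poly_const_pow)
      finally have "[:c, 1:] ^ CARD('p) - [:c, 1:] = monom 1 CARD('p) - monom 1 1"
        by (simp add: monom_altdef)
      moreover have "pcompose (monom 1 k) q = q ^ k" for k and q :: "'p mod_ring poly"
        by (simp add: pcompose_altdef map_poly_monom poly_monom)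
      ultimately show ?thesis by (simp only: pcompose_diff power_one_right)
    qed
    have p: "CARD('p) > 1" using prime_card[where 'a = 'p] prime_gt_1_nat by blast
    have degT: "degree ?T = CARD('p)"
      using p by (subst degree_minus_eq_right) (simp_all add: degree_monom_eq)
    hence Tnz: "?T \<noteq> 0" using p by auto
    have "?T * pcompose h [:c, 1:] = ?T * h" for c
    proof -
      have "?T * pcompose h [:c, 1:] = pcompose (?T * h) [:c, 1:]" by (simp only: pcompose_mult T)
      also have "\<dots> = pcompose ?f [:c, 1:]" unfolding h ..
      also have "\<dots> = ?f" by (simp only: pcompose_diff less.prems pcompose_const)
      finally show ?thesis unfolding h .
    qed
    hence inv: "pcompose h [:c, 1:] = h" for c using Tnz by simp
    have "degree h < degree f"
    proof (cases "h = 0")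
      case nz: False
      have "degree ?f = CARD('p) + degree h" unfolding h using nz Tnz degT by (simp add: degree_mult_eq)
      moreover have "degree ?f \<le> degree f" by (rule degree_diff_le) simp_all
      ultimately show ?thesis using p by simp
    qed (use False in simp)
    from less.hyps[OF this inv] obtain g where g: "h = pcompose g ?T" by blast
    have "f = pcompose (pCons (poly f 0) g) ?T"
      using h unfolding g pcompose_pCons by (metis add.commute diff_add_cancel)
    thus ?thesis by blast
  qed
qed

section \<open>Linearized polynomials over the prime field\<close>

text \<open>The linearized polynomial associated with \<open>A\<close>; \<open>lin_mult\<close> turns products into compositions.\<close>
definition lin :: "'p::prime_card mod_ring poly \<Rightarrow> 'a::comm_ring_1 \<Rightarrow> 'a" where
  "lin A x = (\<Sum>i\<le>degree A. of_Fp (coeff A i) * x ^ (CARD('p) ^ i))"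

text \<open>Modulo Y^p - Y - x this is the constant by which Y^(p^i) exceeds Y; for i = e it is the
  absolute trace of a field with p^e elements.\<close>

definition frob_sum :: "nat \<Rightarrow> nat \<Rightarrow> 'a::comm_semiring_1 \<Rightarrow> 'a" where
  "frob_sum p i x = (\<Sum>j<i. x ^ (p ^ j))"

lemma of_Fp_0 [simp]: "of_Fp 0 = 0" and of_Fp_1 [simp]: "of_Fp 1 = 1"
  by (simp_all add: of_Fp_def)

lemma lin_altdef:
  assumes "degree A \<le> N"
  shows "lin (A :: 'p::prime_card mod_ring poly) x = (\<Sum>i\<le>N. of_Fp (coeff A i) * x ^ (CARD('p) ^ i))"
  unfolding lin_def by (intro sum.mono_neutral_left) (use assms in \<open>auto simp: coeff_eq_0\<close>)

context
  fixes p_type :: "'p::prime_card itself" and a_type :: "'a::comm_ring_1 itself"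
  assumes CHAR: "CHAR('a) = CARD('p)"
begin

interpretation h: comm_ring_hom "of_Fp :: 'p mod_ring \<Rightarrow> 'a"
  by (rule of_Fp_hom[OF CHAR])

lemma prime_CHAR: "prime CHAR('a)" unfolding CHAR by (rule prime_card)

lemma frob_add: "((x :: 'a) + y) ^ (CARD('p) ^ i) = x ^ (CARD('p) ^ i) + y ^ (CARD('p) ^ i)"
  by (rule freshmans_dream'[OF prime_CHAR]) (simp add: CHAR)

lemma sum_frob: "(\<Sum>j\<in>J. f j :: 'a) ^ (CARD('p) ^ i) = (\<Sum>j\<in>J. f j ^ (CARD('p) ^ i))"
  by (rule freshmans_dream_sum'[OF prime_CHAR]) (simp add: CHAR)

lemma of_Fp_frob: "of_Fp (c :: 'p mod_ring) ^ (CARD('p) ^ i) = (of_Fp c :: 'a)"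
proof -
  have "c ^ (CARD('p) ^ i) = c"
    using finite_field_power_card_power_eq_same[of "CARD('p) ^ i" i c] by simp
  thus ?thesis by (metis h.hom_power)
qed

lemma lin_0_left [simp]: "lin (0 :: 'p mod_ring poly) (x :: 'a) = 0"
  by (simp add: lin_def)

lemma lin_add_left: "lin (A + B :: 'p mod_ring poly) (x :: 'a) = lin A x + lin B x"
  using lin_altdef[of "A + B" "max (degree A) (degree B)" x] lin_altdef[of A "max (degree A) (degree B)" x]
    lin_altdef[of B "max (degree A) (degree B)" x]
  by (simp add: degree_add_le h.hom_add algebra_simps sum.distrib)

lemma lin_smult: "lin (smult c (A :: 'p mod_ring poly)) (x :: 'a) = of_Fp c * lin A x"
  using lin_altdef[of "smult c A" "degree A" x] 
  by (simp add: degree_smult_le lin_def h.hom_mult sum_distrib_left mult.assoc)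

lemma lin_minus_left: "lin (A - B :: 'p mod_ring poly) (x :: 'a) = lin A x - lin B x"
  using lin_add_left[of "A - B" B x] by simp

lemma lin_pCons: "lin (pCons c A :: 'p mod_ring poly) (x :: 'a) = of_Fp c * x + lin A (x ^ CARD('p))"
proof -
  have "lin (pCons c A) x = (\<Sum>i\<le>Suc (degree A). of_Fp (coeff (pCons c A) i) * x ^ (CARD('p) ^ i))"
    by (rule lin_altdef) (rule degree_pCons_le)
  also have "\<dots> = of_Fp c * x + lin A (x ^ CARD('p))"
    by (subst sum.atMost_Suc_shift) (simp add: lin_def power_mult)
  finally show ?thesis .
qed

lemma lin_monom: "lin (monom c i :: 'p mod_ring poly) (x :: 'a) = of_Fp c * x ^ (CARD('p) ^ i)"
  by (induction i arbitrary: x) (simp_all add: monom_0 monom_Suc lin_pCons flip: power_mult)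

lemma lin_1: "lin (1 :: 'p mod_ring poly) (x :: 'a) = x"
  using lin_monom[of 1 0 x] by simp

lemma lin_sum_left: "lin (\<Sum>j\<in>J. A j :: 'p mod_ring poly) (x :: 'a) = (\<Sum>j\<in>J. lin (A j) x)"
  by (induction J rule: infinite_finite_induct) (simp_all add: lin_add_left)

lemma lin_add_right: "lin (A :: 'p mod_ring poly) (x + y :: 'a) = lin A x + lin A y"
  by (simp add: lin_def frob_add algebra_simps sum.distrib)

lemma lin_mult_right:
  assumes "u ^ CARD('p) = u"
  shows "lin (A :: 'p mod_ring poly) (u * x :: 'a) = u * lin A x"
proof -
  have "u ^ (CARD('p) ^ i) = u" for i
    by (induction i) (simp_all add: power_mult assms)
  thus ?thesis by (simp add: lin_def power_mult_distrib sum_distrib_left mult_ac)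
qed

lemma lin_minus_right: "lin (A :: 'p mod_ring poly) (x - y :: 'a) = lin A x - lin A y"
  using lin_add_right[of A "x - y" y] by simp

lemma lin_0_right [simp]: "lin (A :: 'p mod_ring poly) (0 :: 'a) = 0"
  using lin_minus_right[of A 0 0] by simp

lemma lin_power: "lin (A :: 'p mod_ring poly) (x :: 'a) ^ CARD('p) = lin A (x ^ CARD('p))"
  using sum_frob[of "\<lambda>i. of_Fp (coeff A i) * x ^ (CARD('p) ^ i)" "{..degree A}" 1] of_Fp_frob[of _ 1]
  by (simp add: lin_def power_mult_distrib power_mult[symmetric] mult.commute)

text \<open>Left multiplication by X becomes the substitution of x^p for x, which passes through
  \<open>lin B\<close> as a p-th power since Frobenius fixes coefficients from the prime
  field.\<close>

lemma lin_mult: "lin (A * B :: 'p mod_ring poly) (x :: 'a) = lin A (lin B x)"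
  by (induction A arbitrary: x)
    (simp_all add: lin_add_left lin_smult lin_pCons lin_power)

text \<open>
  Partial summation. If the digit sum vanishes in the field, then \<open>\<Sum>i. d i * Y ^ (p ^ i)\<close>, which modulo
  the Artin-Schreier polynomial is \<open>\<Sum>i. d i * frob_sum p i x\<close>, is minus the linearized polynomial
  whose coefficients are the prefix sums of \<open>d\<close>.
\<close>
lemma prefix_sum_identity:
  fixes d :: "nat \<Rightarrow> nat" and x :: 'a
  shows "(\<Sum>i<N. of_nat (d i) * frob_sum p i x) + (\<Sum>j<N. of_nat (\<Sum>k\<le>j. d k) * x ^ (p ^ j))
    = of_nat (\<Sum>k<N. d k) * frob_sum p N x"
proof (induction N)
  case (Suc N)
  have *: "(\<Sum>k\<le>N. d k) = (\<Sum>k<N. d k) + d N"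
    by (simp flip: lessThan_Suc_atMost)
  have "(\<Sum>i<Suc N. of_nat (d i) * frob_sum p i x) + (\<Sum>j<Suc N. of_nat (\<Sum>k\<le>j. d k) * x ^ (p ^ j))
    = ((\<Sum>i<N. of_nat (d i) * frob_sum p i x) + (\<Sum>j<N. of_nat (\<Sum>k\<le>j. d k) * x ^ (p ^ j)))
      + (of_nat (d N) * frob_sum p N x + of_nat ((\<Sum>k<N. d k) + d N) * x ^ (p ^ N))"
    by (simp only: sum.lessThan_Suc * add_ac)
  also have "\<dots> = of_nat (\<Sum>k<Suc N. d k) * frob_sum p (Suc N) x"
    unfolding Suc.IH by (simp add: frob_sum_def algebra_simps)
  finally show ?case .
qed (simp add: frob_sum_def)

end

section \<open>Congruences between powers of polynomials\<close>

lemma pcompose_cong: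
  fixes G :: "'f::field poly"
  assumes "[q = r] (mod m)"
  shows "[pcompose G q = pcompose G r] (mod m)"
  by (induction G) (use assms in \<open>auto simp: pcompose_pCons intro!: cong_add cong_mult\<close>)

text \<open>The relation y^q = y acts only where a factor y is present, since y need not be
  invertible modulo m; hence \<open>1 \<le> i\<close>.\<close>

lemma power_cong_reduce:
  fixes y :: "'f::field poly"
  assumes "[y ^ q = y] (mod m)" "1 \<le> q" "1 \<le> i"
  shows "[y ^ (i + k * (q - 1)) = y ^ i] (mod m)"
proof (induction k)
  case (Suc k)
  obtain q' i' where "q = Suc q'" "i = Suc i'"
    using assms(2,3) by (metis Suc_le_D One_nat_def)
  hence "i + Suc k * (q - 1) = (i - 1) + k * (q - 1) + q" "i + k * (q - 1) = (i - 1) + k * (q - 1) + 1"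
    by simp_all
  hence "y ^ (i + Suc k * (q - 1)) = y ^ ((i - 1) + k * (q - 1)) * y ^ q"
    and *: "y ^ (i + k * (q - 1)) = y ^ ((i - 1) + k * (q - 1)) * y"
    by (simp_all only: power_add power_one_right)
  hence "[y ^ (i + Suc k * (q - 1)) = y ^ (i + k * (q - 1))] (mod m)"
    using cong_mult[OF cong_refl assms(1)] by simp
  thus ?case using Suc cong_trans by blast
qed simp

text \<open>Both exponents must be positive for the reduction; \<open>dagger\<close> takes its
  values from 1 upwards, so this applies to it.\<close>

lemma power_cong_exponent:
  fixes y :: "'f::field poly"
  assumes "[y ^ q = y] (mod m)" "1 \<le> q" "1 \<le> i" "1 \<le> j" "[int i = int j] (mod (int q - 1))"
  shows "[y ^ i = y ^ j] (mod m)"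
proof -
  have wlog: "[y ^ i = y ^ j] (mod m)" if ij: "i \<ge> j" "1 \<le> j" "[int i = int j] (mod (int q - 1))" for i j
  proof -
    have "int (q - 1) = int q - 1" using assms(2) by simp
    hence "[i = j] (mod (q - 1))" using ij cong_int_iff[of i j "q - 1"] by simp
    then obtain k where "i = j + k * (q - 1)"
      using ij(1) cong_le_nat[of j i "q - 1"] by (auto simp: add.commute)
    thus ?thesis using power_cong_reduce[OF assms(1,2)] ij by simp
  qed
  show ?thesis
  proof (cases "i \<ge> j")
    case True
    thus ?thesis using assms by (intro wlog)
  next
    case False
    thus ?thesis using assms by (intro cong_sym[OF wlog]) (auto intro: cong_sym)
  qed
qed

section \<open>Computing modulo the Artin-Schreier polynomial\<close>

text \<open>This is 0 unless p = 2, when it is 1.\<close>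
definition Fp_sum :: "'p::prime_card itself \<Rightarrow> 'a::comm_ring_1" where
  "Fp_sum _ = of_Fp (\<Sum>a\<in>(UNIV :: 'p mod_ring set). a)"

definition as_poly :: "'p::prime_card itself \<Rightarrow> 'a::comm_ring_1 \<Rightarrow> 'a poly" where
  "as_poly _ x = monom 1 CARD('p) - monom 1 1 - [:x:]"

definition Fp_trace :: "'p::prime_card itself \<Rightarrow> nat \<Rightarrow> 'a::comm_ring_1 \<Rightarrow> 'a" where
  "Fp_trace _ e x = frob_sum CARD('p) e x"

locale artin_schreier =
  fixes p_type :: "'p::prime_card itself" and x :: "'f::{field,finite}" and e :: nat
  assumes card: "CARD('f) = CARD('p) ^ e" and e: "1 \<le> e"
begin

abbreviation Y :: "'f poly" where "Y \<equiv> [:0, 1:]"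
abbreviation shift :: "'p mod_ring \<Rightarrow> 'f poly" where "shift a \<equiv> [:of_Fp a, 1:]"
abbreviation m where "m \<equiv> as_poly p_type x"
abbreviation c0 :: 'f where "c0 \<equiv> Fp_sum p_type"
abbreviation t where "t \<equiv> Fp_trace p_type e x"

lemma p_prime: "prime CARD('p)" by (rule prime_card)
lemma p_gt_1: "CARD('p) > 1" using p_prime prime_gt_1_nat by blast

lemma CHAR_f: "CHAR('f) = CARD('p)" using CHAR_eq_of_card[OF card p_prime] .
lemma CHAR_fp: "CHAR('f poly) = CARD('p)" by (simp add: CHAR_f)

sublocale h: comm_ring_hom "of_Fp :: 'p mod_ring \<Rightarrow> 'f" by (rule of_Fp_hom[OF CHAR_f])
sublocale hp: comm_ring_hom "of_Fp :: 'p mod_ring \<Rightarrow> 'f poly" by (rule of_Fp_hom[OF CHAR_fp])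
sublocale mp: map_poly_comm_ring_hom "of_Fp :: 'p mod_ring \<Rightarrow> 'f" ..

lemma shift_eq: "shift a = Y + of_Fp a"
  by (simp add: of_Fp_poly)

lemma degree_m: "degree m = CARD('p)"
proof -
  have "m = monom 1 CARD('p) - [:x, 1:]" by (simp add: as_poly_def monom_altdef)
  moreover have "degree (monom 1 CARD('p) - [:x, 1:]) = CARD('p)"
    using p_gt_1 by (subst degree_minus_eq_right) (simp_all add: degree_monom_eq)
  ultimately show ?thesis by simp
qed

lemma const_cong_imp_eq:
  assumes "[[:u:] = [:v:]] (mod m)"
  shows "u = v"
proof -
  have "m dvd [:u - v:]" using assms by (simp add: cong_iff_dvd_diff)
  hence "[:u - v:] = 0" using p_gt_1 degree_m dvd_imp_degree_le[of m "[:u - v:]"] by fastforce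
  thus ?thesis by simp
qed

lemma Y_power_p_cong: "[Y ^ CARD('p) - Y = [:x:]] (mod m)"
  by (simp add: cong_iff_dvd_diff as_poly_def monom_altdef)

lemma frob_sum_frob: "frob_sum CARD('p) (Suc i) x = x + frob_sum CARD('p) i x ^ CARD('p)"
proof -
  have "frob_sum CARD('p) i x ^ CARD('p) = (\<Sum>j<i. x ^ CARD('p) ^ Suc j)"
    using sum_frob[OF CHAR_f, of "\<lambda>j. x ^ CARD('p) ^ j" "{..<i}" 1]
    by (simp add: frob_sum_def mult.commute flip: power_mult)
  thus ?thesis unfolding frob_sum_def by (simp add: sum.lessThan_Suc_shift del: sum.lessThan_Suc)
qed

lemma Y_power_cong: "[Y ^ (CARD('p) ^ i) = Y + [:frob_sum CARD('p) i x:]] (mod m)"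
proof (induction i)
  case (Suc i)
  let ?s = "frob_sum CARD('p) i x"
  have "Y ^ (CARD('p) ^ Suc i) = (Y ^ (CARD('p) ^ i)) ^ CARD('p)" by (simp add: mult.commute flip: power_mult)
  also have "[\<dots> = (Y + [:?s:]) ^ CARD('p)] (mod m)" by (intro cong_pow Suc.IH)
  also have "(Y + [:?s:]) ^ CARD('p) = (Y ^ CARD('p) - Y) + (Y + [:?s ^ CARD('p):])"
    using frob_add[OF CHAR_fp, of Y "[:?s:]" 1] by (simp add: poly_const_pow)
  also have "[\<dots> = [:x:] + (Y + [:?s ^ CARD('p):])] (mod m)"
    by (intro cong_add Y_power_p_cong cong_refl)
  also have "[:x:] + (Y + [:?s ^ CARD('p):]) = Y + [:frob_sum CARD('p) (Suc i) x:]"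
    by (simp add: frob_sum_frob)
  finally show ?case .
qed (simp add: frob_sum_def)

lemma shift_power_cong: "[shift a ^ (CARD('p) ^ i) = shift a + [:frob_sum CARD('p) i x:]] (mod m)"
proof -
  have "shift a ^ (CARD('p) ^ i) = Y ^ (CARD('p) ^ i) + of_Fp a"
    unfolding shift_eq frob_add[OF CHAR_fp] of_Fp_frob[OF CHAR_fp] ..
  also have "[\<dots> = (Y + [:frob_sum CARD('p) i x:]) + of_Fp a] (mod m)"
    by (intro cong_add Y_power_cong cong_refl)
  also have "(Y + [:frob_sum CARD('p) i x:]) + of_Fp a = shift a + [:frob_sum CARD('p) i x:]"
    unfolding shift_eq by (simp add: add_ac)
  finally show ?thesis .
qed

text \<open>Base-p digits write (Y + a)^k, modulo m, as a product of exactly p factors z + a with z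
  independent of a, each z repeated as often as its digit says. By \<open>sum_prod_list_Fp\<close>
  the sum over a collapses to \<open>c0\<close> minus the sum of the z, in which Y occurs p times
  and so cancels.\<close>

lemma sum_shift_power_cong:
  assumes k: "k < CARD('p) ^ N" and ds: "digit_sum CARD('p) k = CARD('p)"
  defines "A \<equiv> (\<Sum>j<N. monom (of_nat (\<Sum>i\<le>j. base_digit CARD('p) k i)) j) :: 'p mod_ring poly"
  shows "[(\<Sum>a\<in>UNIV. shift a ^ k) = [:c0 + lin A x:]] (mod m)"
proof -
  let ?d = "base_digit CARD('p) k"
  let ?z = "\<lambda>i. Y + [:frob_sum CARD('p) i x:]"
  define zs where "zs = concat (map (\<lambda>i. replicate (?d i) (?z i)) [0..<N])"
  have sd: "(\<Sum>i<N. ?d i) = CARD('p)" using digit_sum_eq[OF k p_gt_1] ds by simp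
  have "length zs = sum_list (map ?d [0..<N])"
    by (simp add: zs_def length_concat comp_def)
  hence len: "length zs = CARD('p)" using sd by (simp add: interv_sum_list_conv_sum_set_nat lessThan_atLeast0)
  have prod: "(\<Prod>z\<leftarrow>zs. z + of_Fp a) = (\<Prod>i<N. (?z i + of_Fp a) ^ ?d i)" for a :: "'p mod_ring"
    unfolding zs_def by (induction N) (simp_all add: prod_list_replicate mult.commute)
  have sum: "sum_list zs = (\<Sum>i<N. of_nat (?d i) * ?z i)"
    unfolding zs_def by (induction N) (simp_all add: sum_list_replicate add.commute del: mult_pCons_right)
  have "[(\<Sum>a\<in>UNIV. shift a ^ k) = (\<Sum>a\<in>(UNIV :: 'p mod_ring set). \<Prod>z\<leftarrow>zs. z + of_Fp a)] (mod m)"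
  proof (rule cong_sum)
    fix a :: "'p mod_ring"
    have "k = (\<Sum>i<N. ?d i * CARD('p) ^ i)" using base_digit_expansion[of "CARD('p)" k N] k by simp
    hence "shift a ^ k = shift a ^ (\<Sum>i<N. ?d i * CARD('p) ^ i)" by (rule arg_cong)
    also have "\<dots> = (\<Prod>i<N. (shift a ^ (CARD('p) ^ i)) ^ ?d i)"
      by (simp only: power_sum power_mult[symmetric] mult.commute)
    also have "[\<dots> = (\<Prod>i<N. (shift a + [:frob_sum CARD('p) i x:]) ^ ?d i)] (mod m)"
      by (intro cong_prod cong_pow shift_power_cong)
    also have "(\<Prod>i<N. (shift a + [:frob_sum CARD('p) i x:]) ^ ?d i) = (\<Prod>z\<leftarrow>zs. z + of_Fp a)"
      unfolding prod shift_eq by (simp add: add_ac)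
    finally show "[shift a ^ k = (\<Prod>z\<leftarrow>zs. z + of_Fp a)] (mod m)" .
  qed
  also have "(\<Sum>a\<in>(UNIV :: 'p mod_ring set). \<Prod>z\<leftarrow>zs. z + of_Fp a) = [:c0:] - sum_list zs"
    using sum_prod_list_Fp(3)[where 'p = 'p, OF CHAR_fp, of zs 0] len by (simp add: Fp_sum_def of_Fp_poly)
  also have "sum_list zs = of_nat (\<Sum>i<N. ?d i) * Y + [:\<Sum>i<N. of_nat (?d i) * frob_sum CARD('p) i x:]"
    unfolding sum by (induction N) (simp_all add: algebra_simps of_nat_poly)
  also have "of_nat (\<Sum>i<N. ?d i) = (0 :: 'f poly)"
    unfolding sd using of_nat_CHAR[where 'a = "'f poly"] unfolding CHAR_fp .
  \<comment> \<open>The right side of \<open>prefix_sum_identity\<close> carries the digit sum p as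
    a factor and vanishes.\<close>
  also have "(\<Sum>i<N. of_nat (?d i) * frob_sum CARD('p) i x) = - lin A x"
  proof -
    have "lin A x = (\<Sum>j<N. of_nat (\<Sum>i\<le>j. ?d i) * x ^ (CARD('p) ^ j))"
      unfolding A_def lin_sum_left[OF CHAR_f] lin_monom[OF CHAR_f] h.hom_of_nat ..
    moreover have "of_nat CARD('p) = (0 :: 'f)" using of_nat_CHAR[where 'a = 'f] unfolding CHAR_f .
    ultimately show ?thesis
      using prefix_sum_identity[OF CHAR_f, where d = ?d and N = N and p = "CARD('p)" and x = x] unfolding sd
      by (simp add: eq_neg_iff_add_eq_0)
  qed
  finally show ?thesis by simp
qed

lemma x_power_card: "x ^ (CARD('p) ^ e) = x"
  using finite_field_power_card[of x] by (simp add: card)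

lemma frob_sum_add: "frob_sum q (i + k) (y :: 'f) = frob_sum q i y + (\<Sum>j<k. y ^ (q ^ (i + j)))"
  by (induction k) (simp_all add: frob_sum_def)

text \<open>The powers x^(p^i) have period e in i, so every block of e terms contributes one
  trace.\<close>

lemma frob_sum_mult_e: "frob_sum CARD('p) (j * e) x = of_nat j * t"
proof (induction j)
  case (Suc j)
  have per: "x ^ (CARD('p) ^ (j * e)) = x" for j
    by (induction j) (simp_all add: x_power_card power_add power_mult)
  have "frob_sum CARD('p) (Suc j * e) x = frob_sum CARD('p) (j * e) x + (\<Sum>i<e. x ^ (CARD('p) ^ (j * e + i)))"
    using frob_sum_add[of _ "j * e" e x] by (simp add: add.commute)
  also have "(\<Sum>i<e. x ^ (CARD('p) ^ (j * e + i))) = t"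
    unfolding Fp_trace_def frob_sum_def by (simp only: power_add power_mult[of x] per)
  finally show ?case unfolding Suc.IH by (simp add: algebra_simps)
qed (simp add: frob_sum_def)

text \<open>The sum \<open>frob_sum\<close> with e + 1 terms is x + t^p when its first term is split
  off and t + x when its last one is.\<close>

lemma t_power: "t ^ CARD('p) = t"
proof -
  have "x + t ^ CARD('p) = frob_sum CARD('p) (Suc e) x" by (simp add: Fp_trace_def frob_sum_frob)
  also have "\<dots> = t + x" by (simp add: Fp_trace_def frob_sum_def x_power_card)
  finally show ?thesis by simp
qed

text \<open>The factors are \<open>shift a\<close> plus j t. For nonzero t the j t exhaust the prime
  field, because t lies in it, and the product is w^p - w with w = \<open>shift a\<close>; here a
  drops out by a^p = a, leaving Y^p - Y, congruent to x.\<close>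

lemma prod_shift_cong:
  "[shift a ^ (\<Sum>j<CARD('p). CARD('p) ^ (j * e)) = (if t = 0 then shift a ^ CARD('p) else [:x:])] (mod m)"
proof -
  have "shift a ^ (\<Sum>j<CARD('p). CARD('p) ^ (j * e)) = (\<Prod>j<CARD('p). shift a ^ (CARD('p) ^ (j * e)))"
    by (simp add: power_sum)
  also have "[\<dots> = (\<Prod>j<CARD('p). shift a + [:of_nat j * t:])] (mod m)"
    unfolding frob_sum_mult_e[symmetric] by (intro cong_prod shift_power_cong)
  also have "[(\<Prod>j<CARD('p). shift a + [:of_nat j * t:]) = (if t = 0 then shift a ^ CARD('p) else [:x:])] (mod m)"
  proof (cases "t = 0")
    case False
    have "(\<Prod>j<CARD('p). shift a + [:of_nat j * t:]) = shift a ^ CARD('p) - shift a"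
      using False by (intro prod_add_of_nat_mult CHAR_f t_power)
    also have "\<dots> = Y ^ CARD('p) - Y"
      unfolding shift_eq using frob_add[OF CHAR_fp, of Y "of_Fp a" 1] of_Fp_frob[OF CHAR_fp, of a 1] by simp
    finally show ?thesis using False Y_power_p_cong by simp
  qed simp
  finally show ?thesis .
qed

end

section \<open>The defining identity of g and its values\<close>

lemma g_poly_spec:
  "(\<Sum>a\<in>(UNIV :: 'p::prime_card mod_ring set). [:a, 1:] ^ n) =
    pcompose (g_poly TYPE('p mod_ring) n) (monom 1 CARD('p) - monom 1 1)"
proof -
  let ?f = "\<Sum>a\<in>(UNIV :: 'p mod_ring set). [:a, 1:] ^ n"
  let ?T = "monom 1 CARD('p) - monom 1 1 :: 'p mod_ring poly"
  have p: "CARD('p) > 1" using prime_card[where 'a = 'p] prime_gt_1_nat by blast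
  have id: "map_poly of_Fp g = g" for g :: "'p mod_ring poly"
    by (intro poly_eqI) (simp add: coeff_map_poly)
  have "pcompose ?f [:c, 1:] = ?f" for c
  proof -
    have "pcompose ?f [:c, 1:] = (\<Sum>a\<in>UNIV. ([:a, 1:] \<circ>\<^sub>p [:c, 1:]) ^ n)"
      by (simp only: pcompose_sum pcompose_hom.hom_power)
    also have "(\<lambda>a. [:a, 1:] \<circ>\<^sub>p [:c, 1:]) = (\<lambda>a. [:a + c, 1:])"
      by (simp add: pcompose_pCons pcompose_1 add.commute)
    also have "(\<Sum>a\<in>UNIV. [:a + c, 1:] ^ n) = ?f"
      by (rule sum.reindex_bij_witness[of _ "\<lambda>a. a - c" "\<lambda>a. a + c"]) auto
    finally show ?thesis .
  qed
  then obtain g where g: "?f = pcompose g ?T"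
    using translation_invariant_imp_pcompose by blast
  have degT: "degree ?T = CARD('p)"
    using p by (subst degree_minus_eq_right) (simp_all add: degree_monom_eq)
  \<comment> \<open>Composition with a polynomial of positive degree kills only 0, so the
    description of g determines it.\<close>
  have unique: "g' = g" if "?f = pcompose g' ?T" for g'
  proof -
    have "pcompose (g' - g) ?T = 0" unfolding pcompose_diff using g that by simp
    moreover have "degree ?T > 0" using degT p by linarith
    ultimately have "g' - g = 0" by (rule pcompose_eq_0)
    thus ?thesis by simp
  qed
  have "g_poly TYPE('p mod_ring) n = g"
    unfolding g_poly_def id CARD_mod_ring using g unique by (intro the_equality)
  thus ?thesis using g by simp
qed

lemma bezout_obtain:
  fixes P Q :: "'a::euclidean_ring_gcd"
  obtains U V where "U * P + V * Q = gcd P Q"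
  using bezout_coefficients_fst_snd by blast

text \<open>Taking prefix sums of coefficients is division by 1 - X, up to a boundary term carrying
  the total. It links the digit polynomial of the first gcd condition to its linearized
  counterpart.\<close>

lemma prefix_sum_poly_identity:
  "(1 - monom 1 1) * (\<Sum>j<N. monom (of_nat (\<Sum>k\<le>j. d k) :: 'a::comm_ring_1) j)
    = (\<Sum>j<N. monom (of_nat (d j)) j) - monom (of_nat (\<Sum>k<N. d k)) N"
proof (induction N)
  case (Suc N)
  have "(\<Sum>k\<le>N. d k) = (\<Sum>k<Suc N. d k)" by (simp add: lessThan_Suc_atMost)
  moreover have "(1 - monom 1 1) * monom c N = monom c N - monom c (Suc N)" for c :: 'a
    by (simp add: algebra_simps mult_monom)
  ultimately show ?case
    using Suc by (simp add: distrib_left add_monom[symmetric] del: of_nat_sum)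
qed simp

context artin_schreier
begin

text \<open>For odd p the constant is a power sum of exponent 1 < p - 1 and vanishes; for p = 2 the
  bound on s leaves s = 0.\<close>

lemma Fp_sum_mult_power:
  assumes "s < CARD('p) - 1"
  shows "y ^ (s * k) * c0 = c0"
proof (cases "CARD('p) = 2")
  case True
  thus ?thesis using assms by simp
next
  case False
  hence "c0 = 0"
    using power_sum_Fp(1)[where 'p = 'p, OF CHAR_f, of 1] p_gt_1 by (simp add: Fp_sum_def h.hom_sum)
  thus ?thesis by simp
qed

text \<open>The sum over a is g(Y^p - Y), which modulo m is the constant g(x); constants congruent
  modulo m are equal.\<close>

lemma eval_g_poly:
  assumes "[(\<Sum>a\<in>UNIV. shift a ^ n) = [:v:]] (mod m)"
  shows "poly (map_poly of_Fp (g_poly TYPE('p mod_ring) n :: 'p mod_ring poly)) x = v"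
proof -
  let ?g = "g_poly TYPE('p mod_ring) n :: 'p mod_ring poly"
  have "(\<Sum>a\<in>UNIV. shift a ^ n) = map_poly of_Fp (\<Sum>a\<in>(UNIV :: 'p mod_ring set). [:a, 1:] ^ n)"
    by (simp add: mp.hom_sum mp.hom_power)
  also have "\<dots> = pcompose (map_poly of_Fp ?g) (Y ^ CARD('p) - Y)"
    unfolding g_poly_spec h.map_poly_pcompose
    by (simp only: mp.hom_minus map_poly_monom of_Fp_0 of_Fp_1) (simp add: monom_altdef)
  also have "[\<dots> = pcompose (map_poly of_Fp ?g) [:x:]] (mod m)"
    by (intro pcompose_cong Y_power_p_cong)
  finally have "[[:poly (map_poly of_Fp ?g) x:] = [:v:]] (mod m)"
    using assms cong_trans cong_sym unfolding pcompose_pCons_0 by blast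
  thus ?thesis by (rule const_cong_imp_eq)
qed

text \<open>With nonzero trace the part of n involving \<open>\<alpha>\<close> contributes
  \<open>x ^ \<alpha>\<close>, free of a and Y, and factors out of the sum.\<close>

lemma eval_trace_nonzero:
  assumes "t \<noteq> 0" "\<beta> < CARD('p) ^ N" "digit_sum CARD('p) \<beta> = CARD('p)"
    and "n = \<alpha> * (\<Sum>j<CARD('p). CARD('p) ^ (j * e)) + \<beta>"
  shows "poly (map_poly of_Fp (g_poly TYPE('p mod_ring) n :: 'p mod_ring poly)) x
    = x ^ \<alpha> * (c0 + lin (\<Sum>j<N. monom (of_nat (\<Sum>i\<le>j. base_digit CARD('p) \<beta> i)) j :: 'p mod_ring poly) x)"
    (is "_ = x ^ \<alpha> * ?v")
proof (rule eval_g_poly)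
  have "(\<Sum>a\<in>UNIV. shift a ^ n) = (\<Sum>a\<in>UNIV. (shift a ^ (\<Sum>j<CARD('p). CARD('p) ^ (j * e))) ^ \<alpha> * shift a ^ \<beta>)"
    unfolding assms(4) power_add power_mult[symmetric] by (simp only: mult.commute)
  also have "[\<dots> = (\<Sum>a\<in>UNIV. [:x:] ^ \<alpha> * shift a ^ \<beta>)] (mod m)"
    using prod_shift_cong assms(1) by (intro cong_sum cong_mult cong_pow cong_refl) simp
  also have "(\<Sum>a\<in>UNIV. [:x:] ^ \<alpha> * shift a ^ \<beta>) = [:x:] ^ \<alpha> * (\<Sum>a\<in>UNIV. shift a ^ \<beta>)"
    by (simp only: sum_distrib_left)
  also have "[\<dots> = [:x:] ^ \<alpha> * [:?v:]] (mod m)"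
    by (intro cong_mult cong_refl sum_shift_power_cong assms)
  also have "[:x:] ^ \<alpha> * [:?v:] = [:x ^ \<alpha> * ?v:]" by (simp add: poly_const_pow)
  finally show "[(\<Sum>a\<in>UNIV. shift a ^ n) = [:x ^ \<alpha> * ?v:]] (mod m)" .
qed

text \<open>With zero trace that part contributes (Y + a)^(p \<alpha>), which merges with the
  exponent \<beta>. As (Y + a)^(p^e) is then congruent to Y + a, the positive exponent \<alpha> p +
  \<beta> may be replaced by its representative \<gamma>.\<close>

lemma eval_trace_zero:
  fixes \<alpha> \<beta> :: nat
  assumes "t = 0" "0 < \<beta>"
    and "n = \<alpha> * (\<Sum>j<CARD('p). CARD('p) ^ (j * e)) + \<beta>"
  defines "\<gamma> \<equiv> dagger CARD('p) e (int (\<alpha> * CARD('p) + \<beta>))"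
  assumes "digit_sum CARD('p) \<gamma> = CARD('p)"
  shows "poly (map_poly of_Fp (g_poly TYPE('p mod_ring) n :: 'p mod_ring poly)) x
    = c0 + lin (\<Sum>j<e. monom (of_nat (\<Sum>i\<le>j. base_digit CARD('p) \<gamma> i)) j :: 'p mod_ring poly) x"
    (is "_ = ?v")
proof (rule eval_g_poly)
  note \<gamma> = dagger_props[OF p_gt_1 e, of "int (\<alpha> * CARD('p) + \<beta>)", folded \<gamma>_def]
  have "(\<Sum>a\<in>UNIV. shift a ^ n) = (\<Sum>a\<in>UNIV. (shift a ^ (\<Sum>j<CARD('p). CARD('p) ^ (j * e))) ^ \<alpha> * shift a ^ \<beta>)"
    unfolding assms(3) power_add power_mult[symmetric] by (simp only: mult.commute)
  also have "[\<dots> = (\<Sum>a\<in>UNIV. (shift a ^ CARD('p)) ^ \<alpha> * shift a ^ \<beta>)] (mod m)"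
    using prod_shift_cong assms(1) by (intro cong_sum cong_mult cong_pow cong_refl) simp
  also have "(\<Sum>a\<in>UNIV. (shift a ^ CARD('p)) ^ \<alpha> * shift a ^ \<beta>) = (\<Sum>a\<in>UNIV. shift a ^ (\<alpha> * CARD('p) + \<beta>))"
    unfolding power_add power_mult[symmetric] by (simp only: mult.commute)
  also have "[\<dots> = (\<Sum>a\<in>UNIV. shift a ^ \<gamma>)] (mod m)"
  proof (intro cong_sum power_cong_exponent)
    fix a
    show "[shift a ^ (CARD('p) ^ e) = shift a] (mod m)"
      using shift_power_cong[of a e] assms(1) by (simp add: Fp_trace_def)
  qed (use \<gamma> assms(2) p_gt_1 in \<open>auto intro: cong_sym\<close>)
  also have "[(\<Sum>a\<in>UNIV. shift a ^ \<gamma>) = [:?v:]] (mod m)"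
    by (intro sum_shift_power_cong \<gamma> assms)
  finally show "[(\<Sum>a\<in>UNIV. shift a ^ n) = [:?v:]] (mod m)" .
qed

end

section \<open>Injectivity of the induced map on the field with p^e elements\<close>

theorem theorem3p5:
  fixes p e s \<alpha> \<beta> n :: nat and a b :: "nat \<Rightarrow> nat"
  assumes p: "p = CARD('p::prime_card)"
    and e: "1 \<le> e"
    and s: "s < p - 1"
    and alpha: "\<alpha> = s * ((p ^ e - 1) div (p - 1))"
    and beta: "0 < \<beta>" "\<beta> < p ^ (p * e)"
    and i: "digit_sum p \<beta> = p"
    and ii: "digit_sum p (dagger p e (int (\<alpha> * p + \<beta>))) = p"
    and iii: "gcd (s * e + 1) (p - 1) = 1"
    and a: "\<And>j. a j = base_digit p (dagger p e (int (\<alpha> * p + \<beta>))) j"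
    and b: "\<And>j. b j = base_digit p \<beta> j"
    and gcd_a: "gcd (\<Sum>j<e. monom (of_nat (a j) :: 'p mod_ring) j) (monom 1 e - 1) = monom 1 1 - 1"
    and gcd_b: "gcd (\<Sum>j\<le>p * e - 2. monom (of_nat (\<Sum>k\<le>j. b k) :: 'p mod_ring) j) (monom 1 e - 1) = 1"
    and n: "n = \<alpha> * (\<Sum>j<p. p ^ (j * e)) + \<beta>"
    and F: "CARD('f::{field,finite}) = p ^ e"
  shows "permutation_poly TYPE('f) (g_poly TYPE('p mod_ring) n :: 'p mod_ring poly)"
proof -
  have p1: "1 < p" using prime_card[where 'a = 'p] prime_gt_1_nat p by blast
  have AS: "artin_schreier TYPE('f) TYPE('p) e"
    using F e p by (simp add: artin_schreier_def)
  have CHAR: "CHAR('f) = CARD('p)" using artin_schreier.CHAR_f[OF AS] .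
  have p0: "of_nat p = (0 :: 'p mod_ring)" by (simp add: p)
  define \<gamma> where "\<gamma> = dagger p e (int (\<alpha> * p + \<beta>))"
  define A where "A = (\<Sum>j<e. monom (of_nat (\<Sum>k\<le>j. a k)) j :: 'p mod_ring poly)"
  define B where "B = (\<Sum>j\<le>p * e - 2. monom (of_nat (\<Sum>k\<le>j. b k)) j :: 'p mod_ring poly)"
  define E where "E = (\<Sum>j<e. monom 1 j :: 'p mod_ring poly)"
  define tr :: "'f \<Rightarrow> 'f" where "tr = (\<lambda>x. Fp_trace TYPE('p) e x)"
  \<comment> \<open>The map induced by g without its additive constant.\<close>
  define H where "H = (\<lambda>x :: 'f. if tr x = 0 then lin A x else x ^ \<alpha> * lin B x)"

  have sum_a: "(\<Sum>k<e. a k) = p"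
    using digit_sum_eq[of \<gamma> p e] dagger_props(2)[OF p1 e] p1 ii by (simp add: a \<gamma>_def)
  have sum_b: "(\<Sum>k<p * e. b k) = p"
    using digit_sum_eq[OF beta(2) p1] i by (simp add: b)
  \<comment> \<open>The prefix sum at the last index p e - 1 is the whole digit sum p, zero in the
    field, so the sum may stop at p e - 2. The bound p e \<ge> 2 keeps this subtraction
    exact.\<close>
  have B_alt: "B = (\<Sum>j<p * e. monom (of_nat (\<Sum>k\<le>j. b k)) j)"
  proof -
    have "2 * 1 \<le> p * e" using p1 e by (intro mult_le_mono) auto
    hence "p * e = Suc (Suc (p * e - 2))" by linarith
    then obtain N where N: "p * e = Suc (Suc N)" ..
    have "(\<Sum>k\<le>Suc N. b k) = p" using sum_b by (simp add: N lessThan_Suc_atMost del: sum.atMost_Suc sum.lessThan_Suc)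
    thus ?thesis unfolding B_def N
      by (simp add: lessThan_Suc_atMost p0 del: of_nat_sum sum.atMost_Suc sum.lessThan_Suc)
  qed

  have lin_E: "lin E x = tr x" for x :: 'f
    by (simp add: E_def tr_def Fp_trace_def frob_sum_def lin_sum_left[OF CHAR] lin_monom[OF CHAR])
  \<comment> \<open>The trace is \<open>lin E\<close>, and polynomial multiplication
    commutes.\<close>
  have tr_lin: "tr (lin C x) = lin C (tr x)" for C :: "'p mod_ring poly" and x :: 'f
    unfolding lin_E[symmetric] lin_mult[OF CHAR, symmetric] by (simp only: mult.commute)
  have x_card: "x ^ (p ^ e) = x" for x :: 'f
    using finite_field_power_card[of x] F by simp
  \<comment> \<open>X^e - 1 acts as x^(p^e) - x = 0, so polynomial identities modulo X^e - 1 carry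
    over to the linearized maps.\<close>
  have lin_X: "lin (monom 1 e - 1 :: 'p mod_ring poly) x = 0" for x :: 'f
    using x_card[of x] by (simp add: lin_minus_left[OF CHAR] lin_monom[OF CHAR] lin_1[OF CHAR] p)
  have tr0: "tr 0 = (0 :: 'f)" unfolding lin_E[symmetric] by (rule lin_0_right[OF CHAR])

  obtain U V where "U * B + V * (monom 1 e - 1) = gcd B (monom 1 e - 1)"
    by (rule bezout_obtain)
  hence UV: "U * B + V * (monom 1 e - 1) = 1" using gcd_b unfolding B_def by (rule trans)
  have lin_B_inv: "lin U (lin B x) = x" for x :: 'f
    using arg_cong[OF UV, of "\<lambda>C. lin C x"]
    by (simp add: lin_add_left[OF CHAR] lin_mult[OF CHAR] lin_X lin_1[OF CHAR] lin_0_right[OF CHAR])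
  have lin_B_eq: "lin B x = lin B y \<longleftrightarrow> x = y" for x y :: 'f
    using lin_B_inv by metis

  \<comment> \<open>The digit polynomial is (1 - X) A because the digit sum is 0 in the field, and
    X^e - 1 = (X - 1) E; cancelling X - 1 in the Bezout relation gives V E - U A = 1. On the kernel
    of the trace the term with E vanishes, so -U inverts A there.\<close>
  have lin_A_inj: "x = y" if "tr x = 0" "tr y = 0" "lin A x = lin A y" for x y :: 'f
  proof -
    obtain U V where "U * (\<Sum>j<e. monom (of_nat (a j) :: 'p mod_ring) j) + V * (monom 1 e - 1)
        = gcd (\<Sum>j<e. monom (of_nat (a j)) j) (monom 1 e - 1)"
      by (rule bezout_obtain)
    hence "U * (\<Sum>j<e. monom (of_nat (a j) :: 'p mod_ring) j) + V * (monom 1 e - 1) = monom 1 1 - 1"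
      using gcd_a by (rule trans)
    moreover have "(\<Sum>j<e. monom (of_nat (a j)) j) = (1 - monom 1 1) * A"
      unfolding A_def prefix_sum_poly_identity sum_a p0 by simp
    moreover have "monom 1 e - 1 = (monom 1 1 - 1) * E"
    proof -
      have X: "monom 1 k = (monom 1 1 :: 'p mod_ring poly) ^ k" for k by (simp add: monom_power)
      have "E = (\<Sum>i<e. monom 1 1 ^ i)" unfolding E_def by (rule sum.cong[OF refl X])
      thus ?thesis unfolding X[of e] by (simp only: power_diff_1_eq)
    qed
    ultimately have "(monom 1 1 - 1) * (V * E - U * A) = (monom 1 1 - 1) * 1"
      by (simp add: algebra_simps)
    moreover have "(monom 1 1 - 1 :: 'p mod_ring poly) \<noteq> 0"
    proof
      assume "monom 1 1 - 1 = (0 :: 'p mod_ring poly)"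
      hence "coeff (monom 1 1 - 1 :: 'p mod_ring poly) 1 = coeff 0 1" by (rule arg_cong)
      thus False by simp
    qed
    ultimately have *: "V * E - U * A = 1" by (simp only: mult_cancel_left) simp
    have "lin V (tr z) - lin U (lin A z) = z" for z :: 'f
      using arg_cong[OF *, of "\<lambda>C. lin C z"]
      by (simp add: lin_minus_left[OF CHAR] lin_mult[OF CHAR] lin_1[OF CHAR] lin_E)
    thus ?thesis using that by metis
  qed

  \<comment> \<open>\<open>x ^ M\<close> is the norm to the prime field, and \<alpha> is s M. The
    product form of M shows that \<open>x ^ \<alpha>\<close> is fixed by Frobenius; the sum form
    evaluates \<open>c ^ M\<close> for c in the prime field.\<close>
  define M where "M = (p ^ e - 1) div (p - 1)"
  have M_mult: "M * (p - 1) = p ^ e - 1" and M_sum: "M = (\<Sum>k<e. p ^ k)"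
  proof -
    have "int ((p - 1) * (\<Sum>k<e. p ^ k)) = int (p ^ e - 1)"
      using p1 power_diff_1_eq[of "int p" e] by (simp add: of_nat_diff)
    hence "p ^ e - 1 = (p - 1) * (\<Sum>k<e. p ^ k)" by (simp only: of_nat_eq_iff)
    thus "M * (p - 1) = p ^ e - 1" "M = (\<Sum>k<e. p ^ k)" using p1 by (simp_all add: M_def)
  qed
  have alpha_power: "(x ^ \<alpha>) ^ p = x ^ \<alpha>" if "x \<noteq> 0" for x :: 'f
  proof -
    have "x * x ^ (p ^ e - 1) = x * 1"
      using x_card[of x] p1 by (simp flip: power_Suc)
    hence "x ^ (p ^ e - 1) = 1" using that by simp
    moreover have "\<alpha> * (p - 1) = (p ^ e - 1) * s"
      unfolding alpha M_def[symmetric] M_mult[symmetric] by simp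
    ultimately have "(x ^ \<alpha>) ^ (p - 1) = 1" by (metis power_mult power_one)
    moreover have "(x ^ \<alpha>) ^ p = x ^ \<alpha> * (x ^ \<alpha>) ^ (p - 1)"
      using p1 by (simp flip: power_Suc)
    ultimately show ?thesis by simp
  qed

  \<comment> \<open>The scalar \<open>x ^ \<alpha>\<close> and \<open>lin B\<close> both pass
    through the trace, and injectivity of \<open>lin B\<close> keeps the result nonzero. Together
    with \<open>tr_H0\<close>, the trace of \<open>H x\<close> reveals which case x belongs
    to.\<close>
  have tr_H: "tr (H x) \<noteq> 0" if "tr x \<noteq> 0" for x :: 'f
  proof -
    have x: "x \<noteq> 0" using that tr0 by auto
    have "tr (H x) = lin E (x ^ \<alpha> * lin B x)" using that by (simp add: H_def lin_E)
    also have "\<dots> = x ^ \<alpha> * tr (lin B x)"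
      using alpha_power[OF x] by (subst lin_mult_right[OF CHAR]) (simp_all add: p lin_E)
    finally have "tr (H x) = x ^ \<alpha> * lin B (tr x)" by (simp only: tr_lin)
    moreover have "lin B (tr x) \<noteq> lin B 0" using that by (simp add: lin_B_eq)
    ultimately show ?thesis using x by (simp add: lin_0_right[OF CHAR])
  qed
  have tr_H0: "tr (H x) = 0" if "tr x = 0" for x :: 'f
    using that by (simp add: H_def tr_lin lin_0_right[OF CHAR])

  have nz_case: "x = y" if xy: "tr x \<noteq> 0" "tr y \<noteq> 0" "H x = H y" for x y :: 'f
  proof -
    have nz: "x \<noteq> 0" "y \<noteq> 0" using that tr0 by auto
    \<comment> \<open>Moving \<open>x ^ \<alpha>\<close> and \<open>y ^ \<alpha>\<close> inside
      \<open>lin B\<close> and cancelling \<open>lin B\<close> will give y = c x with c in the prime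
      field.\<close>
    define c where "c = x ^ \<alpha> / y ^ \<alpha>"
    have c0: "c \<noteq> 0" using nz by (simp add: c_def)
    have cp: "c ^ p = c" using alpha_power nz by (simp add: c_def power_divide)
    have "lin B (x ^ \<alpha> * x) = lin B (y ^ \<alpha> * y)"
      using xy alpha_power nz by (simp add: H_def lin_mult_right[OF CHAR] flip: p)
    hence "x ^ \<alpha> * x = y ^ \<alpha> * y" by (simp only: lin_B_eq)
    hence y: "y = c * x" using nz by (simp add: c_def field_simps)
    \<comment> \<open>Frobenius fixes c, so each of the e summands of M contributes one factor c.
      Inserting y = c x into the definition of c then gives c^(s e + 1) = 1.\<close>
    have "c ^ (p ^ k) = c" for k by (induction k) (simp_all add: power_mult cp)
    hence "c ^ M = c ^ e" unfolding M_sum power_sum by simp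
    hence "c ^ \<alpha> = c ^ (s * e)"
      unfolding alpha M_def[symmetric] by (metis mult.commute power_mult)
    hence "y ^ \<alpha> = c ^ (s * e) * x ^ \<alpha>" by (simp add: y power_mult_distrib)
    hence "c ^ (s * e + 1) = 1" using nz by (simp add: c_def field_simps)
    moreover have "c ^ (p - 1) = 1"
    proof -
      have "c * c ^ (p - 1) = c * 1" using cp p1 by (simp flip: power_Suc)
      thus ?thesis using c0 by simp
    qed
    \<comment> \<open>Condition (iii) in Bezout form over the naturals; with c^(p - 1) = 1 it forces
      c = 1.\<close>
    moreover have "\<exists>k l. k * (s * e + 1) = l * (p - 1) + 1"
      using iii bezout_nat[of "s * e + 1" "p - 1"] by (simp add: mult.commute)
    moreover have "k * (s * e + 1) = l * (p - 1) + 1 \<Longrightarrow> (c ^ (s * e + 1)) ^ k = (c ^ (p - 1)) ^ l * c" for k l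
      by (metis mult.commute power_add power_mult power_one_right)
    ultimately have "c = 1" by auto
    thus ?thesis using y by simp
  qed
  have inj_H: "inj H"
  proof (rule injI)
    fix x y :: 'f assume eq: "H x = H y"
    hence "tr x = 0 \<longleftrightarrow> tr y = 0" using tr_H tr_H0 by metis
    thus "x = y" using nz_case[of x y] lin_A_inj[of x y] eq by (cases "tr x = 0") (simp_all add: H_def)
  qed

  have "poly (map_poly of_Fp (g_poly TYPE('p mod_ring) n :: 'p mod_ring poly)) x = Fp_sum TYPE('p) + H x" for x :: 'f
  proof (cases "tr x = 0")
    case True
    thus ?thesis
      using artin_schreier.eval_trace_zero[OF AS, where p_type = "TYPE('p)" and \<alpha> = \<alpha> and \<beta> = \<beta> and n = n and x = x] beta n ii
      by (simp add: tr_def H_def A_def a p)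
  next
    case False
    \<comment> \<open>In \<open>eval_trace_nonzero\<close> the factor \<open>x ^ \<alpha>\<close>
      also multiplies the additive constant; absorbing it gives both cases the same
      constant.\<close>
    have "x ^ \<alpha> * Fp_sum TYPE('p) = Fp_sum TYPE('p)"
      using artin_schreier.Fp_sum_mult_power[OF AS, where p_type = "TYPE('p)"] s unfolding alpha p by blast
    thus ?thesis
      using False artin_schreier.eval_trace_nonzero[OF AS, where p_type = "TYPE('p)" and \<alpha> = \<alpha> and \<beta> = \<beta> and n = n and x = x and N = "p * e"] beta n i
      by (simp add: tr_def H_def B_alt b p distrib_left)
  qed
  hence "(\<lambda>x :: 'f. poly (map_poly of_Fp (g_poly TYPE('p mod_ring) n :: 'p mod_ring poly)) x) = (\<lambda>x. Fp_sum TYPE('p) + H x)"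
    by (rule ext)
  moreover have "inj (\<lambda>x. Fp_sum TYPE('p) + H x)"
    using inj_H by (auto simp: inj_def)
  ultimately show ?thesis
    unfolding permutation_poly_def by (simp add: bij_def finite_UNIV_inj_surj)
qed

end
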